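(* Let $T$ be a rooted tree on vertex set $\{1,\dots,n\}$ with root $1$. Then the space $\mathcal{P}_n(GX_n)$ of homogeneous polynomials of degree $n$ in the central $\mathcal{P}$-space $\mathcal{P}(GX_n)$ is spanned by monomials, and the reference monomials $\{\mathrm{Ref}_{T_k}: k\in\{\pm1\}^n,\ k(1)=1\}$ form a basis of $\mathcal{P}_n(GX_n)$.
   Context: For $k\in\{\pm1\}^n$ with $k(1)=1$, let $T_k$ be the directed tree obtained from $T$ by orienting, for each non-root vertex $i$ with parent $p$, the edge $\{p,i\}$ towards $i$ if $k(i)=1$ and towards $p$ if $k(i)=-1$. The generalized broken wheel graph $GBW_n(T_k)$ is obtained from $T_k$ by adding a vertex $0$, two parallel edges directed from $0$ to $1$, and one edge directed from $0$ to $i$ for each $2\le i\le n$. The weight of a vertex $v\in\{1,\dots,n\}$ is $w_{T_k}(v)=\mathrm{indeg}(v)-1$ (indegree in $GBW_n(T_k)$), and the reference monomial is $\mathrm{Ref}_{T_k}(t)=\prod_{i=1}^n t_i^{w_{T_k}(i)}$. Let $GX_n$ be the $n\times 2n$ matrix whose columns are the vectors $e_j-e_i$ (with $e_0:=0$, $(e_i)$ the standard basis of $\mathbb{R}^n$), one for each edge of the underlying undirected multigraph of $GBW_n(T_k)$ joining $i$ and $j$, with any fixed choice of sign (this does not depend on $k$ up to signs). For $x=\sum\lambda_ie_i$ let $p_x=\sum\lambda_it_i$ and for a sub-multiset $R$ of columns $p_R=\prod_{x\in R}p_x$. The central $\mathcal{P}$-space is $\mathcal{P}(GX_n)=\operatorname{span}\{p_R: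 R\subseteq GX_n,\ GX_n\setminus R \text{ has rank } n\}$. *)

theory Defs
  imports
    "HOL-Analysis.Finite_Function_Topology"
    "HOL-Library.FuncSet"
    "HOL-Library.Multiset"
    "Graph_Theory.Pair_Digraph"
begin

section \<open>Rooted trees and generalized broken wheel graphs\<close>

text \<open>
  A finite simple undirected graph is a \<^locale>\<open>pair_graph\<close>: a finite symmetric loop-free digraph
  without parallel arcs, every edge being present in both directions. It is a tree if any two of
  its vertices are joined by exactly one path (a walk without repeated vertices). The tree
  predicate of the Graph-Theory library is not suitable here: it forbids directed cycles, so it
  fails for every symmetric digraph with an edge. The root is always the vertex 1.
\<close>

definition rooted_tree :: "nat \<Rightarrow> nat pair_pre_digraph \<Rightarrow> bool" where
  "rooted_tree n T \<longleftrightarrow>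
     1 \<le> n \<and> pair_graph T \<and> pverts T = {1..n} \<and>
     (\<forall>u\<in>pverts T. \<forall>v\<in>pverts T. \<exists>!p. pre_digraph.apath (with_proj T) u p v)"

text \<open>The parent of \<open>i\<close> is the vertex following \<open>i\<close> on the path from \<open>i\<close> to the root.\<close>

definition parent :: "nat pair_pre_digraph \<Rightarrow> nat \<Rightarrow> nat" where
  "parent T i = (THE p. \<exists>q. pre_digraph.apath (with_proj T) i ((i, p) # q) 1)"

definition signs :: "nat \<Rightarrow> (nat \<Rightarrow> int) set" where
  "signs n = {k \<in> {1..n} \<rightarrow>\<^sub>E {-1, 1}. k 1 = 1}"

definition orient :: "nat pair_pre_digraph \<Rightarrow> (nat \<Rightarrow> int) \<Rightarrow> nat pair_pre_digraph" where
  "orient T k =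
     \<lparr> pverts = pverts T,
       parcs = (\<lambda>i. if k i = 1 then (parent T i, i) else (i, parent T i)) ` (pverts T - {1}) \<rparr>"

text \<open>
  An arc \<open>(u, v, c)\<close> goes from \<open>u\<close> to \<open>v\<close>; the tag \<open>c\<close> distinguishes parallel arcs.
\<close>

definition GBW :: "nat \<Rightarrow> nat pair_pre_digraph \<Rightarrow> (nat, nat \<times> nat \<times> nat) pre_digraph" where
  "GBW n D =
     \<lparr> verts = insert 0 (pverts D),
       arcs = {(u, v, 0) | u v. (u, v) \<in> parcs D} \<union> {(0, 1, 0), (0, 1, 1)}
                \<union> {(0, i, 0) | i. 2 \<le> i \<and> i \<le> n},
       tail = (\<lambda>(u, v, c). u),
       head = (\<lambda>(u, v, c). v) \<rparr>"

text \<open>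
  Every vertex of \<open>{1..n}\<close> receives an arc from 0, so the subtraction does not truncate.
\<close>

definition weight :: "nat \<Rightarrow> nat pair_pre_digraph \<Rightarrow> nat \<Rightarrow> nat" where
  "weight n D v = in_degree (GBW n D) v - 1"

section \<open>Polynomials\<close>

text \<open>
  Real polynomials in the variables \<open>t\<^sub>0, t\<^sub>1, \<dots>\<close>, as finitely supported functions from exponent
  vectors to coefficients, with the ring structure of \<open>HOL-Library.Poly_Mapping\<close>.
\<close>

type_synonym polynomial = "(nat \<Rightarrow>\<^sub>0 nat) \<Rightarrow>\<^sub>0 real"

definition monomials :: "polynomial set" where
  "monomials = range (\<lambda>m. Poly_Mapping.single m 1)"

definition var :: "nat \<Rightarrow> polynomial" where
  "var i = Poly_Mapping.single (Poly_Mapping.single i 1) 1"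

definition Ref :: "nat \<Rightarrow> nat pair_pre_digraph \<Rightarrow> polynomial" where
  "Ref n D = (\<Prod>i\<in>{1..n}. var i ^ weight n D i)"

definition homogeneous :: "nat \<Rightarrow> polynomial \<Rightarrow> bool" where
  "homogeneous d p \<longleftrightarrow>
     (\<forall>m\<in>Poly_Mapping.keys p. (\<Sum>i\<in>Poly_Mapping.keys m. Poly_Mapping.lookup m i) = d)"

section \<open>The central P-space\<close>

text \<open>
  A vector of \<open>\<real>\<^sup>n\<close> is a finitely supported function whose support lies in \<open>{1..n}\<close>.
\<close>

definition unit :: "nat \<Rightarrow> nat \<Rightarrow>\<^sub>0 real" where
  "unit i = (if i = 0 then 0 else Poly_Mapping.single i 1)"

text \<open>
  The columns form a multiset, indexed by the arcs of the graph of the orientation \<open>k\<close>. The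
  function \<open>s\<close> carries the choice of signs; it takes values in \<open>{-1, 1}\<close>.
\<close>

definition GX ::
  "nat \<Rightarrow> nat pair_pre_digraph \<Rightarrow> (nat \<Rightarrow> int) \<Rightarrow> (nat \<times> nat \<times> nat \<Rightarrow> real) \<Rightarrow> (nat \<Rightarrow>\<^sub>0 real) multiset"
  where
  "GX n T k s =
     (let G = GBW n (orient T k)
      in image_mset (\<lambda>a. s a *\<^sub>R (unit (head G a) - unit (tail G a))) (mset_set (arcs G)))"

definition linear_form :: "(nat \<Rightarrow>\<^sub>0 real) \<Rightarrow> polynomial" where
  "linear_form x = (\<Sum>i\<in>Poly_Mapping.keys x. Poly_Mapping.lookup x i *\<^sub>R var i)"

definition P_space :: "nat \<Rightarrow> (nat \<Rightarrow>\<^sub>0 real) multiset \<Rightarrow> polynomial set" where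
  "P_space n X =
     span {\<Prod>x\<in>#R. linear_form x | R. R \<subseteq># X \<and> dim (set_mset (X - R)) = n}"

definition P_homogeneous :: "nat \<Rightarrow> nat \<Rightarrow> (nat \<Rightarrow>\<^sub>0 real) multiset \<Rightarrow> polynomial set" where
  "P_homogeneous d n X = {p \<in> P_space n X. homogeneous d p}"

end

theory Submission
  imports Defs
begin

text \<open>
  Pair each vertex \<open>i\<close> with two columns: the spoke \<open>\<plusminus>e\<^sub>i\<close> and the tree column \<open>\<plusminus>(e\<^sub>i - e\<^sub>p)\<close>, where \<open>p\<close> is
  the parent of \<open>i\<close>; for the root, both are \<open>\<plusminus>e\<^sub>1\<close>. The reference monomial of \<open>k\<close> is the product over
  \<open>i\<close> of the variable at the head of the tree arc of \<open>i\<close>, so it is \<open>t\<^sub>i\<close> or \<open>t\<^sub>p\<close> for each \<open>i\<close>.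

  Choosing one of the two columns at each vertex leaves a complement of full rank, and the two forms
  span \<open>{t\<^sub>i, t\<^sub>p}\<close>; expanding multilinearly puts every reference monomial into the \<open>P\<close>-space.
  Conversely, let \<open>R\<close> have \<open>n\<close> columns and a basis as complement. A transversal of the supports of
  that basis turns \<open>R\<close> into a family indexed by the vertices whose \<open>i\<close>-th form involves only \<open>t\<^sub>i\<close> and
  \<open>t\<^sub>p\<close>, and expanding again gives a combination of reference monomials. The reference monomials are
  pairwise distinct, as the exponents at a deepest vertex where two sign vectors disagree show.
\<close>

section \<open>Spans of products of polynomials\<close>

lemma lookup_scaleR [simp]: "Poly_Mapping.lookup (r *\<^sub>R x) i = r *\<^sub>R Poly_Mapping.lookup x i"
  for x :: "'a \<Rightarrow>\<^sub>0 'b::real_vector"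
proof -
  have "finite {i. r *\<^sub>R Poly_Mapping.lookup x i \<noteq> 0}"
    by (rule finite_subset[OF _ finite_keys[of x]]) (auto simp: in_keys_iff)
  then show ?thesis
    by (simp add: scaleR_poly_mapping_def)
qed

text \<open>Scalars become constant polynomials, so that linearity of multiplication reduces to the
  ring laws.\<close>

lemma scaleR_eq_single_times: "r *\<^sub>R p = Poly_Mapping.single 0 r * p" for p :: polynomial
proof -
  have "r *\<^sub>R p = Poly_Mapping.map ((*) r) p"
    by (rule poly_mapping_eqI) (simp add: Poly_Mapping.map.rep_eq when_def)
  then show ?thesis
    by (simp add: mult_map_scale_conv_mult)
qed

lemma mult_scaleR_right_polynomial: "p * (r *\<^sub>R q) = r *\<^sub>R (p * q)" for p q :: polynomial
  by (simp add: scaleR_eq_single_times mult.left_commute)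

lemma linear_times_polynomial: "linear ((*) p)" for p :: polynomial
  by (rule linearI) (simp_all add: distrib_left mult_scaleR_right_polynomial)

lemma span_times_polynomial:
  fixes p q :: polynomial
  assumes p: "p \<in> span A" and q: "q \<in> span B" and AB: "\<And>x y. x \<in> A \<Longrightarrow> y \<in> B \<Longrightarrow> x * y \<in> C"
  shows "p * q \<in> span C"
proof -
  have *: "x * q \<in> span C" if "x \<in> A" for x
  proof -
    have "x * q \<in> span ((*) x ` B)"
      using q by (auto simp: linear_span_image[OF linear_times_polynomial])
    moreover have "(*) x ` B \<subseteq> C" using AB that by blast
    ultimately show ?thesis using span_mono by blast
  qed
  have "q * p \<in> span ((*) q ` A)"
    using p by (auto simp: linear_span_image[OF linear_times_polynomial])
  moreover have "span ((*) q ` A) \<subseteq> span C"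
    using * by (intro span_minimal subspace_span) (auto simp: mult.commute)
  ultimately show ?thesis by (auto simp: mult.commute)
qed

text \<open>Multilinear expansion, with the terms indexed by choice functions. It serves both
  inclusions: the choices are signs in one and columns in the other.\<close>

lemma prod_in_span_PiE:
  fixes x :: "'a \<Rightarrow> polynomial"
  assumes "finite I" "\<And>i. i \<in> I \<Longrightarrow> x i \<in> span (g i ` K i)"
  shows "(\<Prod>i\<in>I. x i) \<in> span ((\<lambda>k. \<Prod>i\<in>I. g i (k i)) ` PiE I K)"
  using assms
proof (induction I rule: finite_induct)
  case empty
  then show ?case by (simp add: span_base)
next
  case (insert j I)
  have "x j * (\<Prod>i\<in>I. x i) \<in> span ((\<lambda>k. \<Prod>i\<in>insert j I. g i (k i)) ` PiE (insert j I) K)"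
  proof (rule span_times_polynomial)
    show "x j \<in> span (g j ` K j)" using insert.prems by simp
    show "(\<Prod>i\<in>I. x i) \<in> span ((\<lambda>k. \<Prod>i\<in>I. g i (k i)) ` PiE I K)"
      using insert.IH insert.prems by simp
    fix y z assume "y \<in> g j ` K j" "z \<in> (\<lambda>k. \<Prod>i\<in>I. g i (k i)) ` PiE I K"
    then obtain c k where c: "c \<in> K j" "y = g j c" and k: "k \<in> PiE I K" "z = (\<Prod>i\<in>I. g i (k i))"
      by auto
    have "y * z = (\<Prod>i\<in>insert j I. g i ((k(j := c)) i))"
      using insert.hyps c k by (auto intro!: prod.cong)
    moreover have "k(j := c) \<in> PiE (insert j I) K"
      using c(1) k(1) by (rule PiE_fun_upd)
    ultimately show "y * z \<in> (\<lambda>k. \<Prod>i\<in>insert j I. g i (k i)) ` PiE (insert j I) K" by blast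
  qed
  then show ?case using insert.hyps by simp
qed

lemma linear_linear_form: "linear linear_form"
proof -
  \<comment> \<open>The index set in \<open>linear_form\<close> varies with \<open>x\<close>; a
    common finite superset makes the sums for \<open>x\<close>, \<open>y\<close> and
    \<open>x + y\<close> comparable.\<close>
  have sum_form: "linear_form x = (\<Sum>i\<in>S. Poly_Mapping.lookup x i *\<^sub>R var i)"
    if "finite S" "Poly_Mapping.keys x \<subseteq> S" for x S
    unfolding linear_form_def using that by (intro sum.mono_neutral_left) (auto simp: in_keys_iff)
  show ?thesis
  proof (rule linearI)
    fix x y :: "nat \<Rightarrow>\<^sub>0 real"
    let ?S = "Poly_Mapping.keys x \<union> Poly_Mapping.keys y"
    show "linear_form (x + y) = linear_form x + linear_form y"
      using keys_add[of x y]
      by (simp add: sum_form[of ?S] lookup_add scaleR_add_left sum.distrib)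
  next
    fix r and x :: "nat \<Rightarrow>\<^sub>0 real"
    have "Poly_Mapping.keys (r *\<^sub>R x) \<subseteq> Poly_Mapping.keys x" by (auto simp: in_keys_iff)
    then show "linear_form (r *\<^sub>R x) = r *\<^sub>R linear_form x"
      by (simp add: sum_form[of "Poly_Mapping.keys x"] scaleR_sum_right)
  qed
qed

lemma linear_form_unit: "linear_form (unit i) = (if i = 0 then 0 else var i)"
  by (simp add: linear_form_def unit_def)

section \<open>Transversals of independent vectors\<close>

lemma unit_combination: "x = (\<Sum>i\<in>Poly_Mapping.keys x. Poly_Mapping.lookup x i *\<^sub>R Poly_Mapping.single i 1)"
  for x :: "nat \<Rightarrow>\<^sub>0 real"
  by (rule poly_mapping_eqI) (auto simp: lookup_sum lookup_single when_def in_keys_iff if_distrib cong: if_cong)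

text \<open>Coordinate \<open>i\<close> vanishes on the span of the other singles. The index type is
  left general because the result is applied both to unit vectors and to monomials.\<close>

lemma independent_singles: "independent (range (\<lambda>i. Poly_Mapping.single i (1::real)))"
proof -
  have "Poly_Mapping.single i (1::real) \<notin> span (range (\<lambda>i. Poly_Mapping.single i 1) - {Poly_Mapping.single i 1})" for i :: 'a
  proof
    assume i: "Poly_Mapping.single i (1::real) \<in> span (range (\<lambda>i. Poly_Mapping.single i 1) - {Poly_Mapping.single i 1})"
    have "subspace {x :: 'a \<Rightarrow>\<^sub>0 real. Poly_Mapping.lookup x i = 0}"
      by (auto simp: subspace_def lookup_add)
    then have "span (range (\<lambda>i. Poly_Mapping.single i (1::real)) - {Poly_Mapping.single i 1}) \<subseteq> {x. Poly_Mapping.lookup x i = 0}"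
      by (intro span_minimal) (auto simp: lookup_single when_def)
    with i show False by auto
  qed
  then show ?thesis by (auto simp: dependent_def)
qed

text \<open>The vector \<open>x\<close> is not in the span \<open>W\<close> of the others, so some unit vector of its support is not
  either; that unit vector takes the place of \<open>x\<close> in the induction.\<close>

lemma independent_transversal_aux:
  fixes B :: "(nat \<Rightarrow>\<^sub>0 real) set"
  assumes "finite B" "independent (B \<union> (\<lambda>i. Poly_Mapping.single i 1) ` J)"
    "B \<inter> (\<lambda>i. Poly_Mapping.single i 1) ` J = {}"
  shows "\<exists>\<tau>. inj_on \<tau> B \<and> (\<forall>x\<in>B. \<tau> x \<in> Poly_Mapping.keys x - J)"
  using assms
proof (induction B arbitrary: J rule: finite_induct)
  case empty
  then show ?case by simp
next
  case (insert x B)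
  let ?e = "\<lambda>i. Poly_Mapping.single i (1::real)"
  let ?W = "span (B \<union> ?e ` J)"
  have ins: "insert x B \<union> ?e ` J = insert x (B \<union> ?e ` J)" by auto
  have x: "x \<notin> B \<union> ?e ` J" using insert by auto
  have "x \<notin> ?W" and ind: "independent (B \<union> ?e ` J)"
    using insert.prems(1) x unfolding ins by (auto simp: independent_insert)
  then obtain j where j: "j \<in> Poly_Mapping.keys x" "?e j \<notin> ?W"
    using unit_combination[of x] by (metis (no_types, lifting) span_scale span_sum)
  have jJ: "j \<notin> J" using j(2) by (auto intro: span_base)
  have "independent (B \<union> ?e ` insert j J)"
    using ind j(2) by (simp add: independent_insert)
  moreover have "B \<inter> ?e ` insert j J = {}"
    using j(2) insert.prems(2) span_base[of "?e j" "B \<union> ?e ` J"] by auto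
  ultimately obtain \<tau> where \<tau>: "inj_on \<tau> B" "\<forall>y\<in>B. \<tau> y \<in> Poly_Mapping.keys y - insert j J"
    using insert.IH by blast
  have "inj_on (\<tau>(x := j)) (insert x B)"
    using \<tau> insert.hyps by (auto simp: inj_on_def)
  moreover have "\<forall>y\<in>insert x B. (\<tau>(x := j)) y \<in> Poly_Mapping.keys y - J"
    using \<tau> j jJ by auto
  ultimately show ?case by blast
qed

lemma independent_transversal:
  fixes B :: "(nat \<Rightarrow>\<^sub>0 real) set"
  assumes "finite B" "independent B"
  obtains \<tau> where "inj_on \<tau> B" "\<And>x. x \<in> B \<Longrightarrow> \<tau> x \<in> Poly_Mapping.keys x"
  using independent_transversal_aux[of B "{}"] assms by auto

text \<open>Different arcs can give the same column, as the two arcs from 0 to 1 may. Lifting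
  \<open>R\<close> to a set of arcs keeps them apart and lifts the complement too.\<close>

lemma submultiset_image_mset_set:
  assumes "finite E" "R \<subseteq># image_mset f (mset_set E)"
  obtains A where "A \<subseteq> E" "R = image_mset f (mset_set A)"
    "image_mset f (mset_set E) - R = image_mset f (mset_set (E - A))"
proof -
  have "\<exists>A\<subseteq>E. R = image_mset f (mset_set A)"
    using assms
  proof (induction E arbitrary: R rule: finite_induct)
    case empty
    then show ?case by auto
  next
    case (insert x E)
    show ?case
    proof (cases "f x \<in># R")
      case True
      then obtain R' where R': "R = add_mset (f x) R'" by (meson multi_member_split)
      with insert obtain A where "A \<subseteq> E" "R' = image_mset f (mset_set A)" by auto
      moreover have "x \<notin> A" "finite A"
        using insert.hyps \<open>A \<subseteq> E\<close> by (auto intro: finite_subset)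
      ultimately show ?thesis
        using R' by (intro exI[of _ "insert x A"]) auto
    next
      case False
      \<comment> \<open>Omitting \<open>x\<close> lowers only the count at \<open>f x\<close>, a
        value that does not occur in \<open>R\<close>.\<close>
      have "R \<subseteq># image_mset f (mset_set E)"
      proof (rule mset_subset_eqI)
        fix y
        show "count R y \<le> count (image_mset f (mset_set E)) y"
          using mset_subset_eq_count[OF insert.prems, of y] False insert.hyps
          by (cases "y = f x") (auto simp: not_in_iff)
      qed
      with insert.IH show ?thesis by blast
    qed
  qed
  then obtain A where A: "A \<subseteq> E" "R = image_mset f (mset_set A)" by blast
  have "image_mset f (mset_set E) - R = image_mset f (mset_set E - mset_set A)"
    using A assms(1) finite_subset[OF A(1)] by (simp add: image_mset_Diff msubset_mset_set_iff)
  also have "mset_set E - mset_set A = mset_set (E - A)"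
    using A assms by (simp add: mset_set_Diff)
  finally show thesis using that A by blast
qed

section \<open>Homogeneous polynomials\<close>

definition total_degree :: "(nat \<Rightarrow>\<^sub>0 nat) \<Rightarrow> nat" where
  "total_degree m = (\<Sum>i\<in>Poly_Mapping.keys m. Poly_Mapping.lookup m i)"

lemma homogeneous_iff: "homogeneous e p \<longleftrightarrow> (\<forall>m\<in>Poly_Mapping.keys p. total_degree m = e)"
  by (simp add: homogeneous_def total_degree_def)

lemma total_degree_add: "total_degree (m + m') = total_degree m + total_degree m'"
proof -
  let ?S = "Poly_Mapping.keys m \<union> Poly_Mapping.keys m'"
  have "total_degree x = (\<Sum>i\<in>?S. Poly_Mapping.lookup x i)" if "Poly_Mapping.keys x \<subseteq> ?S" for x
    unfolding total_degree_def using that by (intro sum.mono_neutral_left) (auto simp: in_keys_iff)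
  then show ?thesis
    using keys_add[of m m'] by (simp add: lookup_add sum.distrib)
qed

lemma homogeneous_prod:
  assumes "finite A" "\<And>x. x \<in> A \<Longrightarrow> homogeneous (e x) (f x)"
  shows "homogeneous (\<Sum>x\<in>A. e x) (\<Prod>x\<in>A. f x)"
  using assms
proof (induction A rule: finite_induct)
  case empty
  then show ?case by (simp add: homogeneous_iff total_degree_def)
next
  case (insert x A)
  then have "homogeneous (e x) (f x)" "homogeneous (\<Sum>x\<in>A. e x) (\<Prod>x\<in>A. f x)" by auto
  then have "homogeneous (e x + (\<Sum>x\<in>A. e x)) (f x * (\<Prod>x\<in>A. f x))"
    using keys_mult[of "f x" "\<Prod>x\<in>A. f x"] by (fastforce simp: homogeneous_iff total_degree_add)
  then show ?case using insert.hyps by simp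
qed

lemma subspace_keys: "subspace {p :: 'a \<Rightarrow>\<^sub>0 real. Poly_Mapping.keys p \<subseteq> S}"
  by (auto simp: subspace_def in_keys_iff lookup_add) (metis add.right_neutral subsetD in_keys_iff)

text \<open>Split the generators into those of degree \<open>e\<close> and the rest. The rest
  contribute only monomials of other degrees, so their contribution to \<open>p\<close> must
  vanish.\<close>

lemma homogeneous_in_span:
  assumes "p \<in> span G" "homogeneous e p" "\<And>g. g \<in> G \<Longrightarrow> \<exists>c. homogeneous c g"
  shows "p \<in> span {g \<in> G. homogeneous e g}"
proof -
  let ?H = "{g \<in> G. homogeneous e g}"
  let ?D = "{p :: polynomial. Poly_Mapping.keys p \<subseteq> {m. total_degree m = e}}"
  let ?N = "{p :: polynomial. Poly_Mapping.keys p \<subseteq> {m. total_degree m \<noteq> e}}"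
  have "p \<in> span (?H \<union> (G - ?H))" using assms(1) by (simp add: Un_Diff_cancel2 Un_absorb1)
  then obtain x y where xy: "p = x + y" "x \<in> span ?H" "y \<in> span (G - ?H)"
    unfolding span_Un by auto
  have "span ?H \<subseteq> ?D"
    by (rule span_minimal[OF _ subspace_keys]) (auto simp: homogeneous_iff)
  then have "x \<in> ?D" "p \<in> ?D" using xy assms(2) by (auto simp: homogeneous_iff)
  then have "p - x \<in> ?D" using subspace_diff[OF subspace_keys] by blast
  moreover have "span (G - ?H) \<subseteq> ?N"
  proof (rule span_minimal[OF _ subspace_keys])
    show "G - ?H \<subseteq> ?N" using assms(3) by (fastforce simp: homogeneous_iff)
  qed
  then have "p - x \<in> ?N" using xy by auto
  ultimately have "p - x = 0" by (auto simp flip: keys_eq_empty)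
  then show ?thesis using xy by simp
qed

lemma homogeneous_degree_unique: "homogeneous e p \<Longrightarrow> homogeneous e' p \<Longrightarrow> e \<noteq> e' \<Longrightarrow> p = 0"
  by (metis all_not_in_conv homogeneous_iff keys_eq_empty)

lemma homogeneous_var: "homogeneous 1 (var i)"
  by (simp add: homogeneous_iff var_def total_degree_def)

lemma linear_form_in_span: "linear_form x \<in> span (var ` Poly_Mapping.keys x)"
  unfolding linear_form_def by (intro span_sum span_scale span_base imageI)

lemma homogeneous_linear_form: "homogeneous 1 (linear_form x)"
proof -
  have "span (range var) \<subseteq> {p. Poly_Mapping.keys p \<subseteq> {m. total_degree m = 1}}"
    by (rule span_minimal[OF _ subspace_keys]) (use homogeneous_var in \<open>auto simp: homogeneous_iff\<close>)
  moreover have "linear_form x \<in> span (range var)"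
    using linear_form_in_span span_mono[of "var ` Poly_Mapping.keys x" "range var"] by auto
  ultimately show ?thesis by (auto simp: homogeneous_iff)
qed

section \<open>Unit vectors and families of full rank\<close>

lemma unit_eq_single: "i \<noteq> 0 \<Longrightarrow> unit i = Poly_Mapping.single i 1"
  by (simp add: unit_def)

lemma independent_units: "independent (unit ` {1..n})"
  by (rule independent_mono[OF independent_singles]) (auto simp: unit_eq_single)

lemma keys_unit: "Poly_Mapping.keys (unit i) = {i} - {0}"
  by (simp add: unit_def)

lemma inj_on_unit: "inj_on unit {1..n}"
proof (rule inj_onI)
  fix i j assume "i \<in> {1..n}" "j \<in> {1..n}" "unit i = unit j"
  then have "{i} - {0} = {j} - {0}" by (metis keys_unit)
  then show "i = j" using \<open>i \<in> {1..n}\<close> \<open>j \<in> {1..n}\<close> by auto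
qed

lemma dim_eq_card_imp_inj_independent:
  assumes "finite C" "dim (v ` C) = card C"
  shows "inj_on v C" "independent (v ` C)"
proof -
  obtain B where B: "B \<subseteq> v ` C" "independent B" "v ` C \<subseteq> span B" "card B = dim (v ` C)"
    using basis_exists by blast
  have "card (v ` C) \<le> card C" "card B \<le> card (v ` C)"
    using assms(1) B(1) by (auto intro: card_image_le card_mono)
  then have "card (v ` C) = card C" using assms B by simp
  moreover have "B = v ` C" using calculation assms B(1,4) by (intro card_subset_eq) auto
  ultimately show "inj_on v C" "independent (v ` C)"
    using B assms(1) by (auto simp: eq_card_imp_inj_on)
qed

section \<open>Products of columns and reference monomials\<close>

text \<open>The allowed signs vertex by vertex: this turns \<open>signs n\<close> into a product of
  sets, the form that \<open>prod_in_span_PiE\<close> produces.\<close>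

definition sign_range :: "nat \<Rightarrow> int set" where
  "sign_range i = (if i = 1 then {1} else {-1, 1})"

lemma signs_eq_PiE: "1 \<le> n \<Longrightarrow> signs n = PiE {1..n} sign_range"
proof (intro set_eqI iffI)
  fix k assume "k \<in> signs n"
  then have k: "k \<in> {1..n} \<rightarrow>\<^sub>E {-1, 1}" "k 1 = 1" by (simp_all add: signs_def)
  show "k \<in> PiE {1..n} sign_range"
    by (rule PiE_I) (use PiE_mem[OF k(1)] PiE_arb[OF k(1)] k(2) in \<open>auto simp: sign_range_def\<close>)
next
  fix k assume n: "1 \<le> n" and k: "k \<in> PiE {1..n} sign_range"
  have "k i \<in> {-1, 1}" if "i \<in> {1..n}" for i
    using PiE_mem[OF k that] by (simp add: sign_range_def split: if_splits)
  then have "k \<in> {1..n} \<rightarrow>\<^sub>E {-1, 1}"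
    by (intro PiE_I) (use PiE_arb[OF k] in auto)
  moreover have "k 1 = 1" using PiE_mem[OF k, of 1] n by (simp add: sign_range_def)
  ultimately show "k \<in> signs n" by (simp add: signs_def)
qed

text \<open>Here \<open>a i\<close> and \<open>b i\<close> are the spoke and the tree arc of
  \<open>i\<close>, \<open>q\<close> is the parent map with value 0 at the root, \<open>d\<close> is
  a depth, and \<open>v\<close> gives the column of an arc up to sign. As \<open>unit 0 = 0\<close>,
  both columns of the root are \<open>unit 1\<close> up to sign.\<close>

locale wheel_columns =
  fixes n :: nat and q d :: "nat \<Rightarrow> nat" and a b :: "nat \<Rightarrow> 'e" and v :: "'e \<Rightarrow> nat \<Rightarrow>\<^sub>0 real"
  assumes n: "1 \<le> n" and q_root: "q 1 = 0"
    and q: "\<And>i. i \<in> {2..n} \<Longrightarrow> q i \<in> {1..n}"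
    and depth: "\<And>i. i \<in> {2..n} \<Longrightarrow> d (q i) < d i"
    and inj_a: "inj_on a {1..n}" and inj_b: "inj_on b {1..n}" and disj: "a ` {1..n} \<inter> b ` {1..n} = {}"
    and v_a: "\<And>i. i \<in> {1..n} \<Longrightarrow> v (a i) \<in> {unit i, - unit i}"
    and v_b: "\<And>i. i \<in> {1..n} \<Longrightarrow> v (b i) \<in> {unit i - unit (q i), unit (q i) - unit i}"
begin

abbreviation arc_set where "arc_set \<equiv> a ` {1..n} \<union> b ` {1..n}"

text \<open>The head of the tree arc of \<open>i\<close> under the orientation \<open>k\<close>. For
  \<open>k\<close> in \<open>signs n\<close> and \<open>i\<close> in \<open>{1..n}\<close> it is
  never 0, since the root has sign 1.\<close>

definition sink :: "(nat \<Rightarrow> int) \<Rightarrow> nat \<Rightarrow> nat" where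
  "sink k i = (if k i = 1 then i else q i)"

definition sink_monomial :: "(nat \<Rightarrow> int) \<Rightarrow> polynomial" where
  "sink_monomial k = (\<Prod>i\<in>{1..n}. var (sink k i))"

lemma root_or_nonroot: "i \<in> {1..n} \<Longrightarrow> i = 1 \<or> i \<in> {2..n}" by auto

lemma b_neq_a: "i \<in> {1..n} \<Longrightarrow> j \<in> {1..n} \<Longrightarrow> b i \<noteq> a j"
  using disj by (metis IntI empty_iff imageI)

lemma keys_v_a: "i \<in> {1..n} \<Longrightarrow> Poly_Mapping.keys (v (a i)) = {i}"
  using v_a[of i] by (auto simp: keys_unit)

lemma keys_v_b: "i \<in> {1..n} \<Longrightarrow> Poly_Mapping.keys (v (b i)) \<subseteq> {i, q i} - {0}"
  using v_b[of i] keys_diff[of "unit i" "unit (q i)"] keys_diff[of "unit (q i)" "unit i"]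
  by (auto simp: keys_unit)

lemma v_in_span: "x \<in> arc_set \<Longrightarrow> v x \<in> span (unit ` {1..n})"
proof -
  have *: "unit i \<in> span (unit ` {1..n})" if "i \<in> insert 0 {1..n}" for i
    using that by (cases "i = 0") (auto simp: unit_def[of 0] span_zero intro: span_base)
  assume "x \<in> arc_set"
  then obtain i where i: "i \<in> {1..n}" "x = a i \<or> x = b i" by auto
  then have "q i \<in> insert 0 {1..n}" using root_or_nonroot[of i] q[of i] q_root by auto
  then show ?thesis
    using i v_a[of i] v_b[of i] *[of i] *[of "q i"] by (auto intro: span_diff span_neg)
qed

lemma card_arc_set: "card arc_set = 2 * n"
  using inj_a inj_b disj by (simp add: card_Un_disjoint card_image)

lemma linear_form_in_span_var:
  assumes "i \<in> {1..n}" "Poly_Mapping.keys x \<subseteq> {i, q i} - {0}"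
  shows "linear_form x \<in> span ((\<lambda>c. var (if c = 1 then i else q i)) ` sign_range i)"
proof -
  have "var ` ({i, q i} - {0}) \<subseteq> (\<lambda>c. var (if c = 1 then i else q i)) ` sign_range i"
    using q_root by (cases "i = 1") (auto simp: sign_range_def)
  then show ?thesis
    using linear_form_in_span[of x] span_mono[of "var ` Poly_Mapping.keys x"] assms(2)
    by (meson image_mono order_trans subsetD)
qed

text \<open>Send each column of the complementary basis to a coordinate in its support, injectively. The
  spoke \<open>a j\<close> can only be sent to \<open>j\<close>; so if the tree arc \<open>b i\<close> lies in the complement, then the spoke
  at its assigned coordinate, which is \<open>i\<close> or its parent, lies in \<open>A\<close> and can stand in for \<open>b i\<close>.\<close>

lemma product_in_span_sink_monomials:
  assumes A: "A \<subseteq> arc_set" "card A = n" and dim: "dim (v ` (arc_set - A)) = n"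
  shows "(\<Prod>x\<in>A. linear_form (v x)) \<in> span (sink_monomial ` signs n)"
proof -
  define C where "C = arc_set - A"
  have finA: "finite A" using A by (auto intro: finite_subset)
  \<comment> \<open>There are \<open>2 * n\<close> arcs, so the complement has exactly
    \<open>n\<close>; rank \<open>n\<close> then makes its columns distinct and independent.\<close>
  have C: "finite C" "card C = n"
    using A finA card_arc_set by (auto simp: C_def card_Diff_subset)
  then have vC: "inj_on v C" "independent (v ` C)"
    using dim_eq_card_imp_inj_independent[of C v] dim by (auto simp: C_def)
  then obtain \<tau> where \<tau>: "inj_on \<tau> (v ` C)" "\<And>x. x \<in> v ` C \<Longrightarrow> \<tau> x \<in> Poly_Mapping.keys x"
    using independent_transversal C by blast
  define \<sigma> where "\<sigma> = \<tau> \<circ> v"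
  have \<sigma>: "inj_on \<sigma> C" "\<And>x. x \<in> C \<Longrightarrow> \<sigma> x \<in> Poly_Mapping.keys (v x)"
    using vC \<tau> by (auto simp: \<sigma>_def comp_inj_on)
  have \<sigma>_a: "\<sigma> (a i) = i" if "a i \<in> C" "i \<in> {1..n}" for i
    using \<sigma>(2)[OF that(1)] keys_v_a[OF that(2)] by simp
  have \<sigma>_b: "\<sigma> (b i) \<in> {i, q i} - {0}" "\<sigma> (b i) \<in> {1..n}" if "b i \<in> C" "i \<in> {1..n}" for i
  proof -
    show *: "\<sigma> (b i) \<in> {i, q i} - {0}" using \<sigma>(2)[OF that(1)] keys_v_b[OF that(2)] by blast
    show "\<sigma> (b i) \<in> {1..n}" using * root_or_nonroot[OF that(2)] q[of i] q_root that(2) by auto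
  qed
  define y where "y i = (if b i \<in> C then a (\<sigma> (b i)) else b i)" for i
  have y_in: "y i \<in> A" if i: "i \<in> {1..n}" for i
  proof (cases "b i \<in> C")
    case True
    have "a (\<sigma> (b i)) \<notin> C"
    proof
      assume aC: "a (\<sigma> (b i)) \<in> C"
      then have "\<sigma> (a (\<sigma> (b i))) = \<sigma> (b i)" using \<sigma>_a \<sigma>_b True i by blast
      then have "a (\<sigma> (b i)) = b i" using \<sigma>(1) aC True by (auto dest: inj_onD)
      then show False using b_neq_a[OF i \<sigma>_b(2)[OF True i]] by simp
    qed
    then show ?thesis using \<sigma>_b[OF True i] True by (auto simp: y_def C_def)
  next
    case False
    then show ?thesis using i by (auto simp: y_def C_def)
  qed
  have "inj_on y {1..n}"
  proof (rule inj_onI)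
    fix i j assume ij: "i \<in> {1..n}" "j \<in> {1..n}" "y i = y j"
    show "i = j"
    proof (cases "b i \<in> C"; cases "b j \<in> C")
      assume C': "b i \<in> C" "b j \<in> C"
      then have "a (\<sigma> (b i)) = a (\<sigma> (b j))" using ij by (simp add: y_def)
      then have "\<sigma> (b i) = \<sigma> (b j)" using inj_onD[OF inj_a] \<sigma>_b C' ij by blast
      then have "b i = b j" using \<sigma>(1) C' by (auto dest: inj_onD)
      then show ?thesis using ij inj_b by (auto dest: inj_onD)
    next
      assume C': "b i \<in> C" "b j \<notin> C"
      then show ?thesis using ij b_neq_a[OF ij(2) \<sigma>_b(2)[OF C'(1) ij(1)]] by (simp add: y_def)
    next
      assume C': "b i \<notin> C" "b j \<in> C"
      then show ?thesis using ij b_neq_a[OF ij(1) \<sigma>_b(2)[OF C'(2) ij(2)]] by (simp add: y_def)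
    next
      assume "b i \<notin> C" "b j \<notin> C"
      then show ?thesis using ij inj_b by (auto simp: y_def dest: inj_onD)
    qed
  qed
  \<comment> \<open>An injection of \<open>n\<close> vertices into the \<open>n\<close>-element set
    \<open>A\<close> is onto, so \<open>y\<close> reindexes the product.\<close>
  moreover have "y ` {1..n} = A"
    using y_in A finA calculation by (intro card_subset_eq) (auto simp: card_image)
  ultimately have "(\<Prod>x\<in>A. linear_form (v x)) = (\<Prod>i\<in>{1..n}. linear_form (v (y i)))"
    using prod.reindex[of y "{1..n}" "\<lambda>x. linear_form (v x)"] by simp
  also have "\<dots> \<in> span ((\<lambda>k. \<Prod>i\<in>{1..n}. var (if k i = 1 then i else q i)) ` PiE {1..n} sign_range)"
  proof (rule prod_in_span_PiE)
    fix i assume i: "i \<in> {1..n}"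
    have "Poly_Mapping.keys (v (y i)) \<subseteq> {i, q i} - {0}"
      using keys_v_a keys_v_b[OF i] \<sigma>_b[OF _ i] by (simp add: y_def)
    then show "linear_form (v (y i)) \<in> span ((\<lambda>c. var (if c = 1 then i else q i)) ` sign_range i)"
      using i by (rule linear_form_in_span_var[rotated])
  qed simp
  finally show ?thesis
    by (simp add: signs_eq_PiE[OF n] sink_monomial_def sink_def cong: image_cong)
qed

text \<open>Induction on depth recovers every unit vector: either the spoke gives it directly, or
  the tree column gives it from the unit vector of the parent, which is 0 at the root.\<close>

lemma dim_choice_complement:
  assumes "\<And>i. i \<in> {1..n} \<Longrightarrow> a i \<in> C \<or> b i \<in> C" "C \<subseteq> arc_set"
  shows "dim (v ` C) = n"
proof -
  have "unit i \<in> span (v ` C)" if "i \<in> {1..n}" for i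
    using that
  proof (induction "d i" arbitrary: i rule: less_induct)
    case less
    show ?case
    proof (cases "a i \<in> C")
      case True
      then have "v (a i) \<in> span (v ` C)" by (simp add: span_base)
      then show ?thesis using v_a[OF less.prems] span_neg[of "v (a i)" "v ` C"] by auto
    next
      case False
      then have b: "v (b i) \<in> span (v ` C)" using assms(1)[OF less.prems] by (simp add: span_base)
      have "unit (q i) \<in> span (v ` C)"
        using root_or_nonroot[OF less.prems]
      proof
        assume "i = 1" then show ?thesis using q_root by (simp add: unit_def span_zero)
      next
        assume "i \<in> {2..n}" then show ?thesis using less.hyps q depth by blast
      qed
      moreover have "unit i = unit (q i) + v (b i) \<or> unit i = unit (q i) - v (b i)"
        using v_b[OF less.prems] by auto
      ultimately show ?thesis using b span_add span_diff by metis
    qed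
  qed
  then have "span (unit ` {1..n}) \<subseteq> span (v ` C)"
    by (intro span_minimal) auto
  moreover have "span (v ` C) \<subseteq> span (unit ` {1..n})"
    using v_in_span assms(2) by (intro span_minimal) auto
  ultimately have "dim (v ` C) = dim (unit ` {1..n})"
    by (intro span_eq_dim) auto
  also have "\<dots> = n"
    using independent_units[of n] inj_on_unit[of n] by (simp add: dim_eq_card_independent card_image)
  finally show ?thesis .
qed

lemma sink_monomial_in_span:
  assumes "k \<in> signs n"
  shows "sink_monomial k \<in>
    span {\<Prod>x\<in>A. linear_form (v x) | A. A \<subseteq> arc_set \<and> dim (v ` (arc_set - A)) = n}"
    (is "_ \<in> span ?G")
proof -
  define z where "z i c = (if c then a i else b i)" for i and c :: bool
  have "sink_monomial k \<in> span ((\<lambda>c. \<Prod>i\<in>{1..n}. linear_form (v (z i (c i)))) ` PiE {1..n} (\<lambda>_. UNIV))"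
    unfolding sink_monomial_def
  proof (rule prod_in_span_PiE)
    fix i assume i: "i \<in> {1..n}"
    let ?S = "span ((\<lambda>c. linear_form (v (z i c))) ` UNIV)"
    have ab: "linear_form (v (a i)) \<in> ?S" "linear_form (v (b i)) \<in> ?S"
      by (auto intro!: span_base simp: z_def intro: rev_image_eqI[of True] rev_image_eqI[of False])
    have "linear_form (v (a i)) \<in> {var i, - var i}"
      using v_a[OF i] i by (auto simp: linear_form_unit linear_neg[OF linear_linear_form])
    then have var_i: "var i \<in> ?S" using ab(1) span_neg[OF ab(1)] by auto
    show "var (sink k i) \<in> ?S"
    proof (cases "k i = 1")
      case True
      then show ?thesis using var_i by (simp add: sink_def)
    next
      case False
      \<comment> \<open>A sign other than 1 excludes the root, so the parent is a genuine vertex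
        with its own variable.\<close>
      then have "i \<in> {2..n}" using root_or_nonroot[OF i] assms by (auto simp: signs_def)
      then have "q i \<noteq> 0" using q by fastforce
      then have "linear_form (v (b i)) \<in> {var i - var (q i), var (q i) - var i}"
        using v_b[OF i] i by (auto simp: linear_form_unit linear_diff[OF linear_linear_form])
      then have "var (q i) = var i - linear_form (v (b i)) \<or> var (q i) = var i + linear_form (v (b i))"
        by auto
      then show ?thesis
        using var_i ab(2) False span_add span_diff by (metis sink_def)
    qed
  qed simp
  moreover have "(\<Prod>i\<in>{1..n}. linear_form (v (z i (c i)))) \<in> ?G" for c
  proof -
    let ?y = "\<lambda>i. z i (c i)"
    have inj: "inj_on ?y {1..n}"
    proof (rule inj_onI)
      fix i j assume ij: "i \<in> {1..n}" "j \<in> {1..n}" "?y i = ?y j"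
      show "i = j"
        using ij(3) inj_onD[OF inj_a _ ij(1,2)] inj_onD[OF inj_b _ ij(1,2)]
          b_neq_a[OF ij(1,2)] b_neq_a[OF ij(2,1)] by (cases "c i"; cases "c j") (simp_all add: z_def)
    qed
    have sub: "?y ` {1..n} \<subseteq> arc_set" by (auto simp: z_def)
    \<comment> \<open>Each vertex gives up only one of its two columns; the other stays in the
      complement.\<close>
    have "a i \<notin> ?y ` {1..n} \<or> b i \<notin> ?y ` {1..n}" if i: "i \<in> {1..n}" for i
    proof (cases "c i")
      case True
      have "b i \<noteq> z j (c j)" if j: "j \<in> {1..n}" for j
        using b_neq_a[OF i j] inj_onD[OF inj_b _ i j] True by (metis z_def)
      then show ?thesis by blast
    next
      case False
      have "a i \<noteq> z j (c j)" if j: "j \<in> {1..n}" for j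
        using b_neq_a[OF j i] inj_onD[OF inj_a _ i j] False by (metis z_def)
      then show ?thesis by blast
    qed
    then have "dim (v ` (arc_set - ?y ` {1..n})) = n"
      by (intro dim_choice_complement) auto
    moreover have "(\<Prod>i\<in>{1..n}. linear_form (v (?y i))) = (\<Prod>x\<in>?y ` {1..n}. linear_form (v x))"
      by (subst prod.reindex[OF inj]) (simp add: o_def)
    ultimately show ?thesis using sub by blast
  qed
  then have "span ((\<lambda>c. \<Prod>i\<in>{1..n}. linear_form (v (z i (c i)))) ` PiE {1..n} (\<lambda>_. UNIV)) \<subseteq> span ?G"
    by (intro span_mono) auto
  ultimately show ?thesis by blast
qed

lemma span_sink_monomials:
  "span (sink_monomial ` signs n) = P_homogeneous n n (image_mset v (mset_set arc_set))"
proof -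
  let ?X = "image_mset v (mset_set arc_set)"
  let ?G = "{\<Prod>x\<in>A. linear_form (v x) | A. A \<subseteq> arc_set \<and> dim (v ` (arc_set - A)) = n}"
  have fin: "finite A" if "A \<subseteq> arc_set" for A using that by (auto intro: finite_subset)
  \<comment> \<open>The generators of the \<open>P\<close>-space, rewritten with sets of arcs in
    place of sub-multisets of columns.\<close>
  have gens: "{\<Prod>x\<in>#R. linear_form x | R. R \<subseteq># ?X \<and> dim (set_mset (?X - R)) = n} = ?G" (is "?L = _")
  proof
    show "?L \<subseteq> ?G"
    proof
      fix p assume "p \<in> ?L"
      then obtain R where R: "p = (\<Prod>x\<in>#R. linear_form x)" "R \<subseteq># ?X" "dim (set_mset (?X - R)) = n" by blast
      obtain A where A: "A \<subseteq> arc_set" "R = image_mset v (mset_set A)" "?X - R = image_mset v (mset_set (arc_set - A))"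
        using submultiset_image_mset_set[OF fin[OF order_refl] R(2)] by blast
      then have "p = (\<Prod>x\<in>A. linear_form (v x))" "dim (v ` (arc_set - A)) = n"
        using R by (simp_all add: prod_unfold_prod_mset image_mset.compositionality o_def)
      then show "p \<in> ?G" using A by blast
    qed
    show "?G \<subseteq> ?L"
    proof
      fix p assume "p \<in> ?G"
      then obtain A where A: "p = (\<Prod>x\<in>A. linear_form (v x))" "A \<subseteq> arc_set" "dim (v ` (arc_set - A)) = n" by blast
      let ?R = "image_mset v (mset_set A)"
      have sub: "mset_set A \<subseteq># mset_set arc_set" using A fin by (simp add: msubset_mset_set_iff)
      then have "?X - ?R = image_mset v (mset_set (arc_set - A))"
        using A fin by (simp add: image_mset_Diff[symmetric] mset_set_Diff)
      then have "set_mset (?X - ?R) = v ` (arc_set - A)" by simp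
      moreover have "p = (\<Prod>x\<in>#?R. linear_form x)"
        using A by (simp add: prod_unfold_prod_mset image_mset.compositionality o_def)
      ultimately show "p \<in> ?L" using A(3) image_mset_subseteq_mono[OF sub] by (metis (mono_tags, lifting) mem_Collect_eq)
    qed
  qed
  have hom: "homogeneous (card A) (\<Prod>x\<in>A. linear_form (v x))" if "A \<subseteq> arc_set" for A
    using homogeneous_prod[OF fin[OF that], of "\<lambda>_. 1"] homogeneous_linear_form by simp
  have "P_homogeneous n n ?X = {p \<in> span ?G. homogeneous n p}"
    unfolding P_homogeneous_def P_space_def gens ..
  moreover have "{p \<in> span ?G. homogeneous n p} \<subseteq> span (sink_monomial ` signs n)"
  proof
    fix p assume p: "p \<in> {p \<in> span ?G. homogeneous n p}"
    have "p \<in> span {g \<in> ?G. homogeneous n g}"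
      by (rule homogeneous_in_span) (use p hom in auto)
    moreover have "{g \<in> ?G. homogeneous n g} \<subseteq> span (sink_monomial ` signs n)"
    proof
      fix g assume "g \<in> {g \<in> ?G. homogeneous n g}"
      then obtain A where A: "g = (\<Prod>x\<in>A. linear_form (v x))" "A \<subseteq> arc_set"
        "dim (v ` (arc_set - A)) = n" "homogeneous n g" by blast
      show "g \<in> span (sink_monomial ` signs n)"
      proof (cases "card A = n")
        case True
        then show ?thesis using product_in_span_sink_monomials A by simp
      next
        case False
        \<comment> \<open>As a product of \<open>card A\<close> linear forms, \<open>g\<close> is
          also homogeneous of degree \<open>card A\<close>, which differs from
          \<open>n\<close>.\<close>
        then have "g = 0" using homogeneous_degree_unique A hom by blast
        then show ?thesis by (simp add: span_zero)
      qed
    qed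
    ultimately show "p \<in> span (sink_monomial ` signs n)"
      using span_minimal[OF _ subspace_span] by blast
  qed
  moreover have "span (sink_monomial ` signs n) \<subseteq> {p \<in> span ?G. homogeneous n p}"
  proof -
    have "sink_monomial ` signs n \<subseteq> span ?G" using sink_monomial_in_span by blast
    then have 1: "span (sink_monomial ` signs n) \<subseteq> span ?G" by (rule span_minimal) simp
    have "homogeneous n (sink_monomial k)" for k
      unfolding sink_monomial_def
      using homogeneous_prod[of "{1..n}" "\<lambda>_. 1"] homogeneous_var by simp
    then have "span (sink_monomial ` signs n) \<subseteq> {p. Poly_Mapping.keys p \<subseteq> {m. total_degree m = n}}"
      by (intro span_minimal subspace_keys) (auto simp: homogeneous_iff)
    with 1 show ?thesis by (auto simp: homogeneous_iff)
  qed
  ultimately show ?thesis by blast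
qed

section \<open>Distinctness and independence of the reference monomials\<close>

definition sink_exponent :: "(nat \<Rightarrow> int) \<Rightarrow> nat \<Rightarrow>\<^sub>0 nat" where
  "sink_exponent k = (\<Sum>i\<in>{1..n}. Poly_Mapping.single (sink k i) 1)"

lemma sink_monomial_single: "sink_monomial k = Poly_Mapping.single (sink_exponent k) 1"
proof -
  have "(\<Prod>i\<in>I. var (sink k i)) = Poly_Mapping.single (\<Sum>i\<in>I. Poly_Mapping.single (sink k i) 1) 1"
    if "finite I" for I
    using that by (induction I rule: finite_induct) (simp_all add: var_def mult_single)
  then show ?thesis by (simp add: sink_monomial_def sink_exponent_def)
qed

lemma lookup_sink_exponent: "Poly_Mapping.lookup (sink_exponent k) j = card {i \<in> {1..n}. sink k i = j}"
  by (simp add: sink_exponent_def lookup_sum lookup_single when_def flip: sum.inter_filter)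

text \<open>At a deepest vertex \<open>i\<close> where two sign vectors differ, the arcs from the children of \<open>i\<close> agree, so the
  exponents of \<open>t\<^sub>i\<close> differ by the contribution of the arc between \<open>i\<close> and its parent.\<close>

lemma inj_on_sink_exponent: "inj_on sink_exponent (signs n)"
proof (rule inj_onI, rule ccontr)
  fix k l assume kl: "k \<in> signs n" "l \<in> signs n" "sink_exponent k = sink_exponent l" "k \<noteq> l"
  define D where "D = {i \<in> {1..n}. k i \<noteq> l i}"
  \<comment> \<open>Sign vectors are extensional, so two different ones differ at some vertex of
    \<open>{1..n}\<close>.\<close>
  have "D \<noteq> {}" using kl by (auto simp: D_def signs_def intro: PiE_ext)
  moreover have "finite D" by (simp add: D_def)
  ultimately obtain i where i: "i \<in> D" "\<And>j. j \<in> D \<Longrightarrow> d j \<le> d i"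
    using obtains_MAX[of D d] Max_ge[of "d ` D"] by (metis finite_imageI imageI)
  have i2: "i \<in> {2..n}" using i kl root_or_nonroot[of i] by (auto simp: D_def signs_def)
  then have qi: "q i \<noteq> i" using depth by fastforce
  have agree: "sink k j = i \<longleftrightarrow> sink l j = i" if "j \<in> {1..n} - {i}" for j
  proof (cases "q j = i")
    case True
    then have "j \<in> {2..n}" using root_or_nonroot[of j] that q_root i2 by auto
    then have "d i < d j" using depth True by blast
    then have "j \<notin> D" using i(2) by fastforce
    then show ?thesis using that by (auto simp: D_def sink_def)
  next
    case False
    then show ?thesis using that by (auto simp: sink_def)
  qed
  have count: "card {j \<in> {1..n}. sink m j = i} = card {j \<in> {1..n} - {i}. sink m j = i} + (if m i = 1 then 1 else 0)" for m
  proof -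
    have "{j \<in> {1..n}. sink m j = i} = {j \<in> {1..n} - {i}. sink m j = i} \<union> (if m i = 1 then {i} else {})"
      using i2 qi by (auto simp: sink_def)
    then show ?thesis by (simp add: card_Un_disjoint)
  qed
  have "card {j \<in> {1..n}. sink k j = i} = card {j \<in> {1..n}. sink l j = i}"
    unfolding lookup_sink_exponent[symmetric] kl(3) ..
  moreover have "{j \<in> {1..n} - {i}. sink k j = i} = {j \<in> {1..n} - {i}. sink l j = i}"
    using agree by blast
  ultimately have "(if k i = 1 then 1 else 0 :: nat) = (if l i = 1 then 1 else 0)"
    unfolding count by simp
  then have "k i = 1 \<longleftrightarrow> l i = 1" by (simp split: if_splits)
  moreover have "k i \<in> {-1, 1}" "l i \<in> {-1, 1}" using kl i2 by (auto simp: signs_def PiE_iff)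
  ultimately show False using i by (auto simp: D_def)
qed

lemma inj_on_sink_monomial: "inj_on sink_monomial (signs n)"
proof (rule inj_onI)
  fix k l assume kl: "k \<in> signs n" "l \<in> signs n" "sink_monomial k = sink_monomial l"
  have "Poly_Mapping.keys (sink_monomial k) = Poly_Mapping.keys (sink_monomial l)"
    unfolding kl(3) ..
  then have "sink_exponent k = sink_exponent l" by (simp add: sink_monomial_single)
  then show "k = l" using kl(1,2) by (rule inj_onD[OF inj_on_sink_exponent])
qed

lemma independent_sink_monomials: "independent (sink_monomial ` signs n)"
  by (rule independent_mono[OF independent_singles]) (auto simp: sink_monomial_single)

end

section \<open>The columns of a rooted tree\<close>

definition depth :: "nat pair_pre_digraph \<Rightarrow> nat \<Rightarrow> nat" where
  "depth T i = length (THE p. pre_digraph.apath (with_proj T) i p 1)"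

text \<open>As \<open>i\<close> is not the root, its path to the root starts with an arc to some
  \<open>x\<close>. Dropping this arc leaves the path of \<open>x\<close>, so by uniqueness
  \<open>x\<close> is the parent and its depth is one less.\<close>

lemma rooted_tree_parent:
  assumes T: "rooted_tree n T" and i: "i \<in> {2..n}"
  shows "parent T i \<in> {1..n}" "depth T (parent T i) < depth T i"
proof -
  interpret pair_graph T using T by (simp add: rooted_tree_def)
  have V: "pverts T = {1..n}" and uniq: "\<exists>!p. apath j p 1" if "j \<in> {1..n}" for j
    using T that by (auto simp: rooted_tree_def)
  have depth_eq: "depth T j = length p" if "apath j p 1" "j \<in> {1..n}" for j p
    using the1_equality[OF uniq[OF that(2)] that(1)] by (simp add: depth_def)
  have i': "i \<in> {1..n}" using i by auto
  then obtain p where p: "apath i p 1" using uniq by blast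
  then obtain e q where "p = e # q" using i by (cases p) (auto simp: apath_Nil_iff)
  then obtain x where x: "apath i ((i, x) # q) 1"
    using p by (cases e) (auto simp: apath_Cons_iff)
  have "parent T i = x"
    unfolding parent_def
  proof (rule the_equality)
    show "\<exists>q. apath i ((i, x) # q) 1" using x by blast
    show "y = x" if "\<exists>q. apath i ((i, y) # q) 1" for y
      using that x uniq[OF i'] by blast
  qed
  moreover have qx: "apath x q 1" using x by (simp add: apath_Cons_iff)
  moreover have "x \<in> {1..n}"
    using awalk_hd_in_verts[OF awalkI_apath[OF qx]] V[OF i'] by simp
  ultimately show "parent T i \<in> {1..n}" "depth T (parent T i) < depth T i"
    using depth_eq[OF x i'] depth_eq[OF qx] by auto
qed

section \<open>Arcs of the wheel graph as spokes and tree arcs\<close>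

definition spoke :: "nat \<Rightarrow> nat \<times> nat \<times> nat" where
  "spoke i = (0, i, 0)"

text \<open>The second arc from 0 to the root plays the part of a tree arc entering the root from its
  ``parent'' 0, so that every vertex has one spoke and one tree arc.\<close>

definition parent_or_zero :: "nat pair_pre_digraph \<Rightarrow> nat \<Rightarrow> nat" where
  "parent_or_zero T i = (if i = 1 then 0 else parent T i)"

definition tree_arc :: "nat pair_pre_digraph \<Rightarrow> (nat \<Rightarrow> int) \<Rightarrow> nat \<Rightarrow> nat \<times> nat \<times> nat" where
  "tree_arc T k i = (if i = 1 then (0, 1, 1)
     else if k i = 1 then (parent T i, i, 0) else (i, parent T i, 0))"

lemma arcs_GBW:
  assumes "rooted_tree n T"
  shows "arcs (GBW n (orient T k)) = spoke ` {1..n} \<union> tree_arc T k ` {1..n}"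
proof -
  have n: "1 \<le> n" and V: "pverts T = {1..n}" using assms by (auto simp: rooted_tree_def)
  have N: "{1..n} = insert 1 {2..n}" "{1..n} - {1} = {2..n}" using n by auto
  have "{(u, v, 0) | u v. (u, v) \<in> parcs (orient T k)} = tree_arc T k ` {2..n}"
    unfolding orient_def V N(2) by (force simp: tree_arc_def image_iff)
  moreover have "{(0, i, 0) | i. 2 \<le> i \<and> i \<le> n} = spoke ` {2..n}"
    by (auto simp: spoke_def)
  moreover have "tree_arc T k 1 = (0, 1, 1)" "spoke 1 = (0, 1, 0)"
    by (simp_all add: tree_arc_def spoke_def)
  ultimately show ?thesis
    unfolding N(1) by (auto simp: GBW_def)
qed

text \<open>Tree arcs of two distinct non-root vertices could coincide only if each were the parent
  of the other, which depth forbids.\<close>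

lemma inj_on_tree_arc:
  assumes T: "rooted_tree n T"
  shows "inj_on (tree_arc T k) {1..n}"
proof (rule inj_onI)
  fix i j assume ij: "i \<in> {1..n}" "j \<in> {1..n}" "tree_arc T k i = tree_arc T k j"
  show "i = j"
  proof (cases "i = 1 \<or> j = 1")
    case True
    then show ?thesis using ij by (auto simp: tree_arc_def split: if_splits)
  next
    case False
    then have "i \<in> {2..n}" "j \<in> {2..n}" using ij by auto
    then have "\<not> (parent T i = j \<and> parent T j = i)"
      using rooted_tree_parent(2)[OF T] by (metis less_asym)
    then show ?thesis using ij(3) False by (auto simp: tree_arc_def split: if_splits)
  qed
qed

text \<open>Spokes start at 0. The only tree arc that does so is the one of the root, and its tag is
  1 instead of 0.\<close>

lemma spoke_tree_arc_disjoint: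
  assumes T: "rooted_tree n T"
  shows "spoke ` {1..n} \<inter> tree_arc T k ` {1..n} = {}"
proof -
  have "spoke j \<noteq> tree_arc T k i" if i: "i \<in> {1..n}" for i j
  proof (cases "i = 1")
    case False
    then have "i \<in> {2..n}" using i by auto
    then have "parent T i \<noteq> 0" using rooted_tree_parent(1)[OF T] by fastforce
    then show ?thesis using False i by (auto simp: spoke_def tree_arc_def)
  qed (simp add: spoke_def tree_arc_def)
  then show ?thesis by blast
qed

lemma wheel_columns_GBW:
  assumes T: "rooted_tree n T"
    and s: "\<And>e. e \<in> arcs (GBW n (orient T k)) \<Longrightarrow> s e \<in> {-1, 1}"
  shows "wheel_columns n (parent_or_zero T) (depth T) spoke (tree_arc T k)
    (\<lambda>e. s e *\<^sub>R (unit (head (GBW n (orient T k)) e) - unit (tail (GBW n (orient T k)) e)))"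
proof
  show "1 \<le> n" using T by (simp add: rooted_tree_def)
  show "parent_or_zero T 1 = 0" by (simp add: parent_or_zero_def)
  show "inj_on spoke {1..n}" by (auto simp: inj_on_def spoke_def)
  show "inj_on (tree_arc T k) {1..n}" using inj_on_tree_arc[OF T] .
  show "spoke ` {1..n} \<inter> tree_arc T k ` {1..n} = {}" using spoke_tree_arc_disjoint[OF T] .
  show "parent_or_zero T i \<in> {1..n}" "depth T (parent_or_zero T i) < depth T i" if "i \<in> {2..n}" for i
    using rooted_tree_parent[OF T that] that by (auto simp: parent_or_zero_def)
  let ?v = "\<lambda>e. s e *\<^sub>R (unit (head (GBW n (orient T k)) e) - unit (tail (GBW n (orient T k)) e))"
  have unit0: "unit 0 = 0" by (simp add: unit_def)
  show "?v (spoke i) \<in> {unit i, - unit i}" if "i \<in> {1..n}" for i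
  proof -
    have "s (spoke i) \<in> {-1, 1}" using s that by (simp add: arcs_GBW[OF T])
    then show ?thesis by (auto simp: GBW_def spoke_def unit0)
  qed
  show "?v (tree_arc T k i) \<in> {unit i - unit (parent_or_zero T i), unit (parent_or_zero T i) - unit i}"
    if "i \<in> {1..n}" for i
  proof -
    have "s (tree_arc T k i) \<in> {-1, 1}" using s that by (simp add: arcs_GBW[OF T])
    then show ?thesis by (auto simp: GBW_def tree_arc_def parent_or_zero_def unit0)
  qed
qed

text \<open>The spoke of \<open>v\<close> accounts for the subtracted 1, which leaves the tree arcs
  with head \<open>v\<close>. The condition \<open>k 1 = 1\<close> makes the formula correct at the
  root, whose tree arc has head 1.\<close>

lemma weight_GBW:
  assumes T: "rooted_tree n T" and k: "k \<in> signs n" and v: "v \<in> {1..n}"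
  shows "weight n (orient T k) v = card {i \<in> {1..n}. (if k i = 1 then i else parent_or_zero T i) = v}"
proof -
  let ?S = "{i \<in> {1..n}. (if k i = 1 then i else parent_or_zero T i) = v}"
  have "head (GBW n D) (tree_arc T k i) = (if k i = 1 then i else parent_or_zero T i)" for i D
    using k by (auto simp: GBW_def tree_arc_def parent_or_zero_def signs_def)
  moreover have "head (GBW n D) (spoke i) = i" for i D
    by (simp add: GBW_def spoke_def)
  ultimately have "in_arcs (GBW n (orient T k)) v = insert (spoke v) (tree_arc T k ` ?S)"
    using v by (auto simp: in_arcs_def arcs_GBW[OF T])
  moreover have "spoke v \<notin> tree_arc T k ` ?S"
    using spoke_tree_arc_disjoint[OF T] v by blast
  moreover have "card (tree_arc T k ` ?S) = card ?S"
    by (rule card_image, rule inj_on_subset[OF inj_on_tree_arc[OF T]]) auto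
  ultimately show ?thesis by (simp add: weight_def in_degree_def)
qed

text \<open>Groups the factors by their variable, to match the form of \<open>Ref\<close>.\<close>

lemma (in wheel_columns) sink_monomial_eq_prod_power:
  assumes "k \<in> signs n"
  shows "sink_monomial k = (\<Prod>j\<in>{1..n}. var j ^ card {i \<in> {1..n}. sink k i = j})"
proof -
  have "sink k ` {1..n} \<subseteq> {1..n}"
  proof
    fix v assume "v \<in> sink k ` {1..n}"
    then obtain i where i: "i \<in> {1..n}" "v = sink k i" by blast
    then show "v \<in> {1..n}" using root_or_nonroot[of i] q[of i] assms by (auto simp: sink_def signs_def)
  qed
  then have "sink_monomial k = (\<Prod>j\<in>{1..n}. \<Prod>i\<in>{i \<in> {1..n}. sink k i = j}. var (sink k i))"
    unfolding sink_monomial_def by (intro prod.group[symmetric]) auto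
  also have "\<dots> = (\<Prod>j\<in>{1..n}. var j ^ card {i \<in> {1..n}. sink k i = j})"
    by (intro prod.cong) (simp_all flip: prod_constant)
  finally show ?thesis .
qed

theorem theorem6:
  fixes n :: nat
    and T :: "nat pair_pre_digraph"
    and k\<^sub>0 :: "nat \<Rightarrow> int"
    and s :: "nat \<times> nat \<times> nat \<Rightarrow> real"
  assumes "rooted_tree n T"
    and "k\<^sub>0 \<in> signs n"
    and "\<And>a. a \<in> arcs (GBW n (orient T k\<^sub>0)) \<Longrightarrow> s a \<in> {-1, 1}"
  shows "(\<exists>M \<subseteq> monomials. P_homogeneous n n (GX n T k\<^sub>0 s) = span M) \<and>
         inj_on (\<lambda>k. Ref n (orient T k)) (signs n) \<and>
         independent ((\<lambda>k. Ref n (orient T k)) ` signs n) \<and>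
         span ((\<lambda>k. Ref n (orient T k)) ` signs n) = P_homogeneous n n (GX n T k\<^sub>0 s)"
proof -
  let ?v = "\<lambda>e. s e *\<^sub>R (unit (head (GBW n (orient T k\<^sub>0)) e) - unit (tail (GBW n (orient T k\<^sub>0)) e))"
  interpret wheel_columns n "parent_or_zero T" "depth T" spoke "tree_arc T k\<^sub>0" ?v
    using assms by (intro wheel_columns_GBW)
  \<comment> \<open>The columns come from the fixed orientation \<open>k\<^sub>0\<close>, but
    \<open>sink_monomial\<close> depends only on the parent map and \<open>k\<close>, so one
    interpretation covers all sign vectors.\<close>
  have Ref_eq: "Ref n (orient T k) = sink_monomial k" if "k \<in> signs n" for k
    unfolding Ref_def sink_monomial_eq_prod_power[OF that] sink_def
    by (rule prod.cong) (simp_all add: weight_GBW[OF assms(1) that])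
  then have img: "(\<lambda>k. Ref n (orient T k)) ` signs n = sink_monomial ` signs n"
    by (simp cong: image_cong)
  have GX: "GX n T k\<^sub>0 s = image_mset ?v (mset_set arc_set)"
    by (simp add: GX_def Let_def arcs_GBW[OF assms(1)])
  have span: "span (sink_monomial ` signs n) = P_homogeneous n n (GX n T k\<^sub>0 s)"
    unfolding GX by (rule span_sink_monomials)
  moreover have "sink_monomial ` signs n \<subseteq> monomials"
    by (auto simp: monomials_def sink_monomial_single)
  moreover have "inj_on (\<lambda>k. Ref n (orient T k)) (signs n)"
    using inj_on_sink_monomial by (simp add: Ref_eq cong: inj_on_cong)
  ultimately show ?thesis
    unfolding img using independent_sink_monomials by (metis (no_types, lifting))
qed

end
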